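(* Let $2\le r<\infty$, $2^{r-1}\le n\le2^r-1$, $\tau\in\mathbf R^n$, and let $f:\mathbf R^n\to\mathcal A_r$ be an original. Let $u$ be either (i) the spherical kernel (S) or (ii) the Cartesian kernel (C). Then for $p\in W_f$ $$\mathcal F^n(f(t-\tau),u;p;\zeta)=\mathcal F^n(f(t),u;p;\zeta+\langle p,\tau]),$$ where $\langle p,\tau]=p_0s_1+p_1s_1i_1+\dots+p_ns_ni_n$ with $s_j=s_j(n;\tau)=\tau_j+\dots+\tau_n$ in case (i), and $\langle p,\tau]=p_0(\tau_1+\dots+\tau_n)+\sum_{j=1}^np_j\tau_ji_j$ in case (ii).
   Context: Cayley–Dickson algebras: $\mathcal A_0=\mathbf R$ and $\mathcal A_{r+1}=\mathcal A_r\oplus\mathcal A_r\mathbf l$ with $(\xi+\eta\mathbf l)(\gamma+\delta\mathbf l)=(\xi\gamma-\delta^*\eta)+(\delta\xi+\eta\gamma^* )\mathbf l$, $(\xi+\eta\mathbf l)^*=\xi^*-\eta\mathbf l$. The standard basis of $\mathcal A_r$ is $i_0=1,i_1,\dots,i_{2^r-1}$, with $i_j^2=-1$, $i_ji_k=-i_ki_j$ for $j\ne k$, $j,k\ge1$. $\mathrm{Re}(z)=(z+z^* )/2$, $|z|^2=zz^*$, $\exp(z)=\sum_kz^k/k!$. Write $p=\sum_jp_ji_j$, $\zeta=\sum_j\zeta_ji_j$ with real $p_j,\zeta_j$. When $n<2^r-1$ one puts $p_m=\zeta_m=t_m=0$ for $m>n$. Originals: $f:\mathbf R^n\to\mathcal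 A_r$ is an original if (1) $f$ is continuous almost everywhere for the Lebesgue measure; (2) each partial function $t_j\mapsto f(t)$ has on each finite interval only finitely many discontinuities, all of the first kind; (3) each partial function $g_j(t_j)=f(t)$ satisfies, except possibly at its discontinuities of the first kind, a Hölder condition $|g_j(t_j+h)-g_j(t_j)|\le A_j|h|^{\alpha_j}$ for $|h|<\delta_j$, with constants $0<\alpha_j\le1$, $A_j,\delta_j>0$ (for the given $t$); (4) there are real $a_1(f),a_{-1}(f)$ and constants $C_v>0$ such that for each $v\in\{-1,1\}^n$, $|f(t)|<C_v\exp(\sum_ja_{v_j}t_j)$ whenever $v_jt_j\ge0$ for all $j$. $W_f=\{p\in\mathcal A_r:a_1(f)<\mathrm{Re}(p)<a_{-1}(f)\}$. Kernels: (C) Cartesian: $u(p,t;\zeta)=p_0(t_1+\dots+t_n)+\sum_{j=1}^np_jt_ji_j+\zeta$. (S) Spherical: with $s_j=t_j+\dots+t_n$, $K=2^r-1$, $\phi_j=p_js_j+\zeta_j$: $u=p_0s_1+M+\zeta_0$, $M=\phi_1[i_1\cos\phi_2+i_2\sin\phi_2\cos\phi_3+\dots+i_{K-1}\sin\phi_2\cdots\sin\phi_{K-1}\cos\phi_K+i_K\sin\phi_2\cdots\sin\phi_K]$. Transform: $\mathcal F^n(f(t),u;p;\zeta)=\int_{\mathbf R^n}f(t)\exp(-u(p,t;\zeta))\,dt$. *)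

theory Defs
  imports "HOL-Analysis.Analysis" "HOL-Library.Function_Algebras"
begin

text \<open>
  Elements of every Cayley--Dickson algebra are coordinate sequences with respect to the standard
  basis \<open>i\<^sub>0 = 1, i\<^sub>1, i\<^sub>2, \<dots>\<close>; the \<open>r\<close>-th algebra consists of the sequences supported on
  indices below \<open>2 ^ r\<close>.  The basis is numbered by the doubling process: for \<open>k < 2 ^ r\<close> the
  unit with index \<open>2 ^ r + k\<close> is \<open>i\<^sub>k \<^bold>l\<close>.  Addition and negation of sequences are
  the pointwise ones; the pointwise product (and the constant sequence \<open>1\<close>) is never used.
  Topological notions refer to the product topology on \<open>nat \<Rightarrow> real\<close>, which on each of
  these finite-dimensional spaces is the Euclidean topology.
\<close>

type_synonym cd = "nat \<Rightarrow> real"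

definition cd_carrier :: "nat \<Rightarrow> cd set" where
  "cd_carrier r = {x. \<forall>k\<ge>2 ^ r. x k = 0}"

definition cd_unit :: "nat \<Rightarrow> cd" where
  "cd_unit j = (\<lambda>k. if k = j then 1 else 0)"

definition cd_scale :: "real \<Rightarrow> cd \<Rightarrow> cd" where
  "cd_scale c x = (\<lambda>k. c * x k)"

text \<open>An element \<open>x\<close> of the algebra with index \<open>Suc r\<close> is
  \<open>cd_fst r x + cd_snd r x \<^bold>l\<close>.\<close>

definition cd_fst :: "nat \<Rightarrow> cd \<Rightarrow> cd" where
  "cd_fst r x = (\<lambda>k. if k < 2 ^ r then x k else 0)"

definition cd_snd :: "nat \<Rightarrow> cd \<Rightarrow> cd" where
  "cd_snd r x = (\<lambda>k. if k < 2 ^ r then x (2 ^ r + k) else 0)"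

definition cd_pair :: "nat \<Rightarrow> cd \<Rightarrow> cd \<Rightarrow> cd" where
  "cd_pair r \<xi> \<eta> = (\<lambda>k. if k < 2 ^ r then \<xi> k
                        else if k < 2 ^ Suc r then \<eta> (k - 2 ^ r) else 0)"

primrec cd_conj :: "nat \<Rightarrow> cd \<Rightarrow> cd" where
  "cd_conj 0 x = cd_scale (x 0) (cd_unit 0)"
| "cd_conj (Suc r) x = cd_pair r (cd_conj r (cd_fst r x)) (- cd_snd r x)"

primrec cd_mult :: "nat \<Rightarrow> cd \<Rightarrow> cd \<Rightarrow> cd" where
  "cd_mult 0 x y = cd_scale (x 0 * y 0) (cd_unit 0)"
| "cd_mult (Suc r) x y =
     (let \<xi> = cd_fst r x; \<eta> = cd_snd r x; \<gamma> = cd_fst r y; \<delta> = cd_snd r y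
      in cd_pair r (cd_mult r \<xi> \<gamma> - cd_mult r (cd_conj r \<delta>) \<eta>)
                   (cd_mult r \<delta> \<xi> + cd_mult r \<eta> (cd_conj r \<gamma>)))"

text \<open>Both \<open>(z + z\<^sup>*) / 2\<close> and \<open>z z\<^sup>*\<close> are real multiples of \<open>i\<^sub>0\<close>, so the real numbers they
  denote are read off from the coordinate \<open>0\<close>.\<close>

definition cd_Re :: "nat \<Rightarrow> cd \<Rightarrow> real" where
  "cd_Re r z = (z 0 + cd_conj r z 0) / 2"

definition cd_norm :: "nat \<Rightarrow> cd \<Rightarrow> real" where
  "cd_norm r z = sqrt (cd_mult r z (cd_conj r z) 0)"

text \<open>The algebras are power-associative, so the bracketing of powers is immaterial.\<close>

primrec cd_power :: "nat \<Rightarrow> cd \<Rightarrow> nat \<Rightarrow> cd" where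
  "cd_power r z 0 = cd_unit 0"
| "cd_power r z (Suc k) = cd_mult r z (cd_power r z k)"

definition cd_exp :: "nat \<Rightarrow> cd \<Rightarrow> cd" where
  "cd_exp r z = (\<lambda>j. \<Sum>k. cd_power r z k j / fact k)"


definition partial_fun :: "(real ^ 'n \<Rightarrow> cd) \<Rightarrow> real ^ 'n \<Rightarrow> 'n \<Rightarrow> real \<Rightarrow> cd" where
  "partial_fun f t j = (\<lambda>x. f (\<chi> i. if i = j then x else t $ i))"

definition first_kind_discont :: "(real \<Rightarrow> cd) \<Rightarrow> real \<Rightarrow> bool" where
  "first_kind_discont g x \<longleftrightarrow> \<not> isCont g x \<and>
     (\<exists>l. (g \<longlongrightarrow> l) (at_left x)) \<and> (\<exists>l. (g \<longlongrightarrow> l) (at_right x))"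

text \<open>Here \<open>a 1\<close> and \<open>a (- 1)\<close> are the growth exponents of \<open>f\<close>; other values of \<open>a\<close> are
  irrelevant.  The Hoelder constants may depend on the point \<open>t\<close> and on the coordinate \<open>j\<close>.\<close>

definition cd_original :: "nat \<Rightarrow> (int \<Rightarrow> real) \<Rightarrow> (real ^ 'n::finite \<Rightarrow> cd) \<Rightarrow> bool" where
  "cd_original r a f \<longleftrightarrow>
     range f \<subseteq> cd_carrier r \<and>
     (AE t in lebesgue. isCont f t) \<and>
     (\<forall>t j. (\<forall>b c. finite {x \<in> {b..c}. \<not> isCont (partial_fun f t j) x}) \<and>
            (\<forall>x. \<not> isCont (partial_fun f t j) x \<longrightarrow> first_kind_discont (partial_fun f t j) x)) \<and>
     (\<forall>t j. \<not> first_kind_discont (partial_fun f t j) (t $ j) \<longrightarrow>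
        (\<exists>A \<alpha> \<delta>. 0 < A \<and> 0 < \<alpha> \<and> \<alpha> \<le> 1 \<and> 0 < \<delta> \<and>
           (\<forall>h. \<bar>h\<bar> < \<delta> \<longrightarrow>
              cd_norm r (partial_fun f t j (t $ j + h) - partial_fun f t j (t $ j))
                \<le> A * \<bar>h\<bar> powr \<alpha>))) \<and>
     (\<forall>v :: 'n \<Rightarrow> int. range v \<subseteq> {- 1, 1} \<longrightarrow>
        (\<exists>C>0. \<forall>t. (\<forall>j. 0 \<le> of_int (v j) * t $ j) \<longrightarrow>
           cd_norm r (f t) < C * exp (\<Sum>j\<in>UNIV. a (v j) * t $ j)))"

definition cd_strip :: "nat \<Rightarrow> (int \<Rightarrow> real) \<Rightarrow> cd set" where
  "cd_strip r a = {p \<in> cd_carrier r. a 1 < cd_Re r p \<and> cd_Re r p < a (- 1)}"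


text \<open>In what follows \<open>n = CARD('n)\<close> and \<open>e\<close> enumerates the coordinates of \<open>real ^ 'n\<close> by
  \<open>1, \<dots>, n\<close>, so that \<open>t\<^sub>j\<close> is \<open>t $ e j\<close>.  For \<open>j > n\<close> the sum defining \<open>s\<^sub>j\<close> is empty, in
  accordance with the convention \<open>t\<^sub>m = 0\<close> for \<open>m > n\<close>.\<close>

definition tail_sum :: "(nat \<Rightarrow> 'n::finite) \<Rightarrow> nat \<Rightarrow> real ^ 'n \<Rightarrow> real" where
  "tail_sum e j t = (\<Sum>i=j..CARD('n). t $ e i)"

definition kernel_cartesian ::
    "(nat \<Rightarrow> 'n::finite) \<Rightarrow> cd \<Rightarrow> real ^ 'n \<Rightarrow> cd \<Rightarrow> cd" where
  "kernel_cartesian e p t \<zeta> =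
     cd_scale (p 0 * (\<Sum>j=1..CARD('n). t $ e j)) (cd_unit 0)
     + (\<Sum>j=1..CARD('n). cd_scale (p j * t $ e j) (cd_unit j)) + \<zeta>"

definition kernel_spherical ::
    "nat \<Rightarrow> (nat \<Rightarrow> 'n::finite) \<Rightarrow> cd \<Rightarrow> real ^ 'n \<Rightarrow> cd \<Rightarrow> cd" where
  "kernel_spherical r e p t \<zeta> =
     (let K = 2 ^ r - 1;
          \<phi> = (\<lambda>j. p j * tail_sum e j t + \<zeta> j);
          M = cd_scale (\<phi> 1)
                ((\<Sum>m=1..K - 1. cd_scale ((\<Prod>l=2..m. sin (\<phi> l)) * cos (\<phi> (m + 1))) (cd_unit m))
                 + cd_scale (\<Prod>l=2..K. sin (\<phi> l)) (cd_unit K))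
      in cd_scale (p 0 * tail_sum e 1 t) (cd_unit 0) + M + cd_scale (\<zeta> 0) (cd_unit 0))"

definition bracket_cartesian :: "(nat \<Rightarrow> 'n::finite) \<Rightarrow> cd \<Rightarrow> real ^ 'n \<Rightarrow> cd" where
  "bracket_cartesian e p \<tau> =
     cd_scale (p 0 * (\<Sum>j=1..CARD('n). \<tau> $ e j)) (cd_unit 0)
     + (\<Sum>j=1..CARD('n). cd_scale (p j * \<tau> $ e j) (cd_unit j))"

definition bracket_spherical :: "(nat \<Rightarrow> 'n::finite) \<Rightarrow> cd \<Rightarrow> real ^ 'n \<Rightarrow> cd" where
  "bracket_spherical e p \<tau> =
     cd_scale (p 0 * tail_sum e 1 \<tau>) (cd_unit 0)
     + (\<Sum>j=1..CARD('n). cd_scale (p j * tail_sum e j \<tau>) (cd_unit j))"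


text \<open>The integral of a function with values in a Cayley--Dickson algebra is taken coordinatewise;
  it exists if all coordinates are Lebesgue integrable.\<close>

definition transform_integrand ::
    "nat \<Rightarrow> (real ^ 'n \<Rightarrow> cd) \<Rightarrow> (cd \<Rightarrow> real ^ 'n \<Rightarrow> cd \<Rightarrow> cd) \<Rightarrow> cd \<Rightarrow> cd \<Rightarrow> real ^ 'n \<Rightarrow> cd" where
  "transform_integrand r f u p \<zeta> t = cd_mult r (f t) (cd_exp r (- u p t \<zeta>))"

definition transform_exists ::
    "nat \<Rightarrow> (real ^ 'n::finite \<Rightarrow> cd) \<Rightarrow> (cd \<Rightarrow> real ^ 'n \<Rightarrow> cd \<Rightarrow> cd) \<Rightarrow> cd \<Rightarrow> cd \<Rightarrow> bool" where
  "transform_exists r f u p \<zeta> \<longleftrightarrow>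
     (\<forall>k. integrable lebesgue (\<lambda>t. transform_integrand r f u p \<zeta> t k))"

definition transform ::
    "nat \<Rightarrow> (real ^ 'n::finite \<Rightarrow> cd) \<Rightarrow> (cd \<Rightarrow> real ^ 'n \<Rightarrow> cd \<Rightarrow> cd) \<Rightarrow> cd \<Rightarrow> cd \<Rightarrow> cd" where
  "transform r f u p \<zeta> = (\<lambda>k. integral\<^sup>L lebesgue (\<lambda>t. transform_integrand r f u p \<zeta> t k))"

end

theory Submission
  imports Defs
begin

text \<open>
  Both kernels satisfy \<open>u(p, t + \<tau>; \<zeta>) = u(p, t; \<zeta> + \<langle>p, \<tau>])\<close>, so the identity is the translation
  invariance of Lebesgue measure once the integrals are known to exist.  Since the imaginary part
  of \<open>u\<close> contributes only a rotation, \<open>\<bar>exp (- u)\<bar> = exp (- Re u)\<close> with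
  \<open>Re u = p\<^sub>0 (t\<^sub>1 + \<dots> + t\<^sub>n) + \<zeta>\<^sub>0\<close>; on each orthant the growth condition on \<open>f\<close> and
  \<open>a\<^sub>1 < p\<^sub>0 < a\<^sub>-\<^sub>1\<close> bound the integrand by a multiple of \<open>exp (- c (\<bar>t\<^sub>1\<bar> + \<dots> + \<bar>t\<^sub>n\<bar>))\<close>.
\<close>

section \<open>Cayley--Dickson algebra\<close>

text \<open>Each doubling step conjugates the first half and negates the second, so only coordinate
  0 keeps its sign. This closed form lets later facts about conjugation avoid the recursion.\<close>

lemma cd_conj_apply: "cd_conj r x k = (if k = 0 then x 0 else if k < 2 ^ r then - x k else 0)"
  by (induction r arbitrary: x k)
    (auto simp: cd_scale_def cd_unit_def cd_pair_def cd_fst_def cd_snd_def)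

lemma cd_fst_add: "cd_fst r (x + y) = cd_fst r x + cd_fst r y"
  and cd_snd_add: "cd_snd r (x + y) = cd_snd r x + cd_snd r y"
  and cd_conj_add: "cd_conj r (x + y) = cd_conj r x + cd_conj r y"
  and cd_fst_scale: "cd_fst r (cd_scale c x) = cd_scale c (cd_fst r x)"
  and cd_snd_scale: "cd_snd r (cd_scale c x) = cd_scale c (cd_snd r x)"
  and cd_conj_scale: "cd_conj r (cd_scale c x) = cd_scale c (cd_conj r x)"
  by (auto simp: fun_eq_iff cd_fst_def cd_snd_def cd_conj_apply cd_scale_def)

lemma cd_pair_add: "cd_pair r x y + cd_pair r x' y' = cd_pair r (x + x') (y + y')"
  and cd_pair_scale: "cd_scale c (cd_pair r x y) = cd_pair r (cd_scale c x) (cd_scale c y)"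
  by (auto simp: fun_eq_iff cd_pair_def cd_scale_def)

lemma cd_scale_add_right: "cd_scale c (x + y) = cd_scale c x + cd_scale c y"
  and cd_scale_diff_right: "cd_scale c (x - y) = cd_scale c x - cd_scale c y"
  and cd_scale_add_left: "cd_scale (c + d) x = cd_scale c x + cd_scale d x"
  and cd_scale_scale: "cd_scale c (cd_scale d x) = cd_scale (c * d) x"
  and cd_scale_zero: "cd_scale 0 x = 0"
  and cd_scale_minus_one: "cd_scale (- 1) x = - x"
  by (auto simp: fun_eq_iff cd_scale_def algebra_simps)

text \<open>Both laws go through one induction: in the doubling formula the components of the left
  factor also occur as right factors (\<open>\<eta>\<close> in \<delta>* \<eta>), so each law at
  \<open>Suc r\<close> uses both laws at \<open>r\<close>. The same holds for
  \<open>cd_mult_scale\<close>.\<close>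

lemma cd_mult_add:
  shows cd_mult_add_left: "cd_mult r (x + x') y = cd_mult r x y + cd_mult r x' y"
    and cd_mult_add_right: "cd_mult r x (y + y') = cd_mult r x y + cd_mult r x y'"
proof (induction r arbitrary: x x' y y')
  case 0
  { case 1 show ?case by (simp add: cd_scale_add_left distrib_right) }
  { case 2 show ?case by (simp add: cd_scale_add_left distrib_left) }
next
  case (Suc r)
  { case 1 show ?case
      by (simp only: cd_mult.simps Let_def cd_fst_add cd_snd_add cd_pair_add Suc)
        (simp only: algebra_simps) }
  { case 2 show ?case
      by (simp only: cd_mult.simps Let_def cd_fst_add cd_snd_add cd_pair_add cd_conj_add Suc)
        (simp only: algebra_simps) }
qed

lemma cd_mult_scale:
  shows cd_mult_scale_left: "cd_mult r (cd_scale c x) y = cd_scale c (cd_mult r x y)"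
    and cd_mult_scale_right: "cd_mult r x (cd_scale c y) = cd_scale c (cd_mult r x y)"
proof (induction r arbitrary: x y)
  case 0
  { case 1 show ?case by (simp add: cd_scale_def mult_ac) }
  { case 2 show ?case by (simp add: cd_scale_def mult_ac) }
next
  case (Suc r)
  { case 1 show ?case
      by (simp add: Let_def cd_fst_scale cd_snd_scale cd_pair_scale Suc
          cd_scale_add_right cd_scale_diff_right) }
  { case 2 show ?case
      by (simp add: Let_def cd_fst_scale cd_snd_scale cd_conj_scale cd_pair_scale Suc
          cd_scale_add_right cd_scale_diff_right) }
qed

lemma cd_mult_zero [simp]: "cd_mult r 0 y = 0" "cd_mult r x 0 = 0"
  using cd_mult_scale_left[of r 0 x y] cd_mult_scale_right[of r x 0 y]
  by (simp_all add: cd_scale_zero)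

lemma cd_mult_minus: "cd_mult r (- x) y = - cd_mult r x y" "cd_mult r x (- y) = - cd_mult r x y"
  using cd_mult_scale_left[of r "- 1" x y] cd_mult_scale_right[of r x "- 1" y]
  by (simp_all add: cd_scale_minus_one)

lemma cd_fst_carrier [simp]: "cd_fst r x \<in> cd_carrier r"
  and cd_snd_carrier [simp]: "cd_snd r x \<in> cd_carrier r"
  by (auto simp: cd_carrier_def cd_fst_def cd_snd_def)

lemma cd_pair_fst_snd: "x \<in> cd_carrier (Suc r) \<Longrightarrow> cd_pair r (cd_fst r x) (cd_snd r x) = x"
  by (auto simp: fun_eq_iff cd_carrier_def cd_pair_def cd_fst_def cd_snd_def)

lemma cd_fst_unit_0 [simp]: "cd_fst r (cd_unit 0) = cd_unit 0"
  and cd_snd_unit_0 [simp]: "cd_snd r (cd_unit 0) = 0"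
  and cd_conj_unit_0 [simp]: "cd_conj r (cd_unit 0) = cd_unit 0"
  by (auto simp: fun_eq_iff cd_fst_def cd_snd_def cd_unit_def cd_conj_apply)

lemma cd_conj_zero [simp]: "cd_conj r 0 = 0"
  by (simp add: fun_eq_iff cd_conj_apply)

lemma cd_mult_unit_0:
  assumes "x \<in> cd_carrier r"
  shows "cd_mult r (cd_unit 0) x = x" "cd_mult r x (cd_unit 0) = x"
  using assms
proof (induction r arbitrary: x)
  case 0
  { case 1 then show ?case by (auto simp: fun_eq_iff cd_scale_def cd_unit_def cd_carrier_def) }
  { case 2 then show ?case by (auto simp: fun_eq_iff cd_scale_def cd_unit_def cd_carrier_def) }
next
  case (Suc r)
  { case 1 then show ?case by (simp add: Let_def Suc cd_pair_fst_snd) }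
  { case 2 then show ?case by (simp add: Let_def Suc cd_pair_fst_snd) }
qed

section \<open>Conjugation, the norm and bounds for products\<close>

lemma cd_conj_conj: "x \<in> cd_carrier r \<Longrightarrow> cd_conj r (cd_conj r x) = x"
  by (auto simp: fun_eq_iff cd_conj_apply cd_carrier_def)

lemma cd_conj_minus: "cd_conj r (- x) = - cd_conj r x"
  by (simp add: fun_eq_iff cd_conj_apply)

lemma cd_fst_conj: "cd_fst r (cd_conj (Suc r) x) = cd_conj r (cd_fst r x)"
  and cd_snd_conj: "cd_snd r (cd_conj (Suc r) x) = - cd_snd r x"
  by (auto simp: fun_eq_iff cd_fst_def cd_snd_def cd_conj_apply simp del: cd_conj.simps)

text \<open>The squared Euclidean length of the coordinate vector; \<open>cd_norm_eq\<close>
  identifies its root with \<open>cd_norm\<close>.\<close>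

definition cd_sq :: "nat \<Rightarrow> cd \<Rightarrow> real" where
  "cd_sq r x = (\<Sum>k<2 ^ r. (x k)\<^sup>2)"

lemma cd_sq_Suc: "cd_sq (Suc r) x = cd_sq r (cd_fst r x) + cd_sq r (cd_snd r x)"
proof -
  have "{..<(2::nat) ^ Suc r} = {..<2 ^ r} \<union> {2 ^ r..<2 ^ r + 2 ^ r}" by auto
  moreover have "(\<Sum>k = 2 ^ r..<2 ^ r + 2 ^ r. (x k)\<^sup>2) = (\<Sum>k<2 ^ r. (x (2 ^ r + k))\<^sup>2)"
    using sum.shift_bounds_nat_ivl[of "\<lambda>k. (x k)\<^sup>2" 0 "2 ^ r" "2 ^ r"]
    by (simp add: atLeast0LessThan add.commute)
  ultimately show ?thesis
    by (simp add: cd_sq_def cd_fst_def cd_snd_def sum.union_disjoint ivl_disj_int)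
qed

text \<open>For x = \<xi> + \<eta> l the second component of x x* is - \<eta> \<xi> + \<eta> \<xi> =
  0 and the first is \<xi> \<xi>* + \<eta>* \<eta>. Both orders of the factors occur there, hence
  the joint induction; associativity never enters.\<close>

lemma cd_mult_conj:
  assumes "x \<in> cd_carrier r"
  shows "cd_mult r x (cd_conj r x) = cd_scale (cd_sq r x) (cd_unit 0)"
    and "cd_mult r (cd_conj r x) x = cd_scale (cd_sq r x) (cd_unit 0)"
  using assms
proof (induction r arbitrary: x)
  case 0
  { case 1 show ?case by (simp add: cd_sq_def cd_scale_def cd_unit_def power2_eq_square) }
  { case 2 show ?case by (simp add: cd_sq_def cd_scale_def cd_unit_def power2_eq_square) }
next
  case (Suc r)
  have eq: "cd_pair r (cd_scale c (cd_unit 0)) 0 = cd_scale c (cd_unit 0)" for c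
    by (auto simp: fun_eq_iff cd_pair_def cd_scale_def cd_unit_def)
  { case 1 show ?case
      by (simp del: cd_conj.simps add: Let_def cd_fst_conj cd_snd_conj Suc cd_mult_minus
          cd_conj_conj cd_conj_minus cd_sq_Suc eq flip: cd_scale_add_left) }
  { case 2 show ?case
      by (simp del: cd_conj.simps add: Let_def cd_fst_conj cd_snd_conj Suc cd_mult_minus
          cd_conj_conj cd_conj_minus cd_sq_Suc eq flip: cd_scale_add_left) }
qed

lemma cd_norm_eq: "x \<in> cd_carrier r \<Longrightarrow> cd_norm r x = sqrt (cd_sq r x)"
  by (simp add: cd_norm_def cd_mult_conj cd_scale_def cd_unit_def)

lemma abs_le_sqrt_cd_sq: "k < 2 ^ r \<Longrightarrow> \<bar>x k\<bar> \<le> sqrt (cd_sq r x)"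
  unfolding cd_sq_def by (rule real_le_rsqrt) (auto intro!: member_le_sum)

text \<open>The norm is not multiplicative for large \<open>r\<close>, but a crude bound is enough
  for integrability: every coordinate at level \<open>Suc r\<close> is a sum or difference of two
  coordinates of products at level \<open>r\<close>, so the constant doubles at each step.\<close>

lemma abs_cd_mult_le:
  assumes "\<And>k. k < 2 ^ r \<Longrightarrow> \<bar>x k\<bar> \<le> X" "\<And>k. k < 2 ^ r \<Longrightarrow> \<bar>y k\<bar> \<le> Y" "0 \<le> X" "0 \<le> Y"
  shows "\<bar>cd_mult r x y k\<bar> \<le> 2 ^ r * X * Y"
  using assms
proof (induction r arbitrary: x y X Y k)
  case 0
  then show ?case by (auto simp: cd_scale_def cd_unit_def abs_mult intro!: mult_mono)
next
  case (Suc r)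
  have X: "\<bar>cd_fst r x k\<bar> \<le> X" "\<bar>cd_snd r x k\<bar> \<le> X" for k
    using Suc.prems(1)[of k] Suc.prems(1)[of "2 ^ r + k"] Suc.prems(3)
    by (auto simp: cd_fst_def cd_snd_def)
  have Y: "\<bar>cd_fst r y k\<bar> \<le> Y" "\<bar>cd_snd r y k\<bar> \<le> Y" for k
    using Suc.prems(2)[of k] Suc.prems(2)[of "2 ^ r + k"] Suc.prems(4)
    by (auto simp: cd_fst_def cd_snd_def)
  have Y': "\<bar>cd_conj r (cd_fst r y) k\<bar> \<le> Y" "\<bar>cd_conj r (cd_snd r y) k\<bar> \<le> Y" for k
    using Y[of k] Y[of 0] Suc.prems(4) by (auto simp: cd_conj_apply)
  have b: "\<bar>cd_mult r (cd_fst r x) (cd_fst r y) k\<bar> \<le> 2 ^ r * X * Y"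
     "\<bar>cd_mult r (cd_snd r x) (cd_conj r (cd_fst r y)) k\<bar> \<le> 2 ^ r * X * Y" for k
    by (intro Suc.IH X Y Y' Suc.prems)+
  have "\<bar>cd_mult r (cd_conj r (cd_snd r y)) (cd_snd r x) k\<bar> \<le> 2 ^ r * Y * X"
     "\<bar>cd_mult r (cd_snd r y) (cd_fst r x) k\<bar> \<le> 2 ^ r * Y * X" for k
    by (intro Suc.IH X Y Y' Suc.prems)+
  then have c: "\<bar>cd_mult r (cd_conj r (cd_snd r y)) (cd_snd r x) k\<bar> \<le> 2 ^ r * X * Y"
     "\<bar>cd_mult r (cd_snd r y) (cd_fst r x) k\<bar> \<le> 2 ^ r * X * Y" for k
    by (simp_all add: mult_ac)
  have le: "\<bar>u - v\<bar> \<le> 2 * 2 ^ r * X * Y" "\<bar>u + v\<bar> \<le> 2 * 2 ^ r * X * Y"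
    if "\<bar>u\<bar> \<le> 2 ^ r * X * Y" "\<bar>v\<bar> \<le> 2 ^ r * X * Y" for u v
    using that by linarith+
  show ?case
    using le(1)[OF b(1)[of k] c(1)[of k]] le(2)[OF c(2)[of "k - 2 ^ r"] b(2)[of "k - 2 ^ r"]] Suc.prems(3,4)
    by (simp add: Let_def cd_pair_def)
qed


section \<open>The exponential function\<close>

text \<open>The imaginary part \<open>M\<close> of \<open>z\<close> satisfies \<open>M\<^sup>2 = - \<bar>M\<bar>\<^sup>2\<close>, so \<open>z\<close> generates a copy of the
  complex numbers in which \<open>M\<close> plays the role of \<open>\<i> \<bar>M\<bar>\<close>.  For \<open>M = 0\<close> the division by
  \<open>\<bar>M\<bar>\<close> is harmless because the second summand vanishes.\<close>

lemma cd_power_eq: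
  fixes z M :: cd and r k :: nat
  defines "M \<equiv> z - cd_scale (z 0) (cd_unit 0)"
  defines "m \<equiv> sqrt (cd_sq r M)"
  assumes "z \<in> cd_carrier r"
  shows "cd_power r z k = cd_scale (Re (Complex (z 0) m ^ k)) (cd_unit 0)
                          + cd_scale (Im (Complex (z 0) m ^ k) / m) M"
proof -
  have M: "M \<in> cd_carrier r" "M 0 = 0"
    using assms(3) by (auto simp: M_def cd_carrier_def cd_scale_def cd_unit_def)
  have "cd_conj r M = - M"
    using M by (auto simp: fun_eq_iff cd_conj_apply cd_carrier_def)
  moreover have "m * m = cd_sq r M" by (simp add: m_def cd_sq_def sum_nonneg)
  ultimately have "- cd_mult r M M = cd_scale (m * m) (cd_unit 0)"
    using cd_mult_conj(1)[OF M(1)] by (simp add: cd_mult_minus)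
  then have MM: "cd_mult r M M = cd_scale (- (m * m)) (cd_unit 0)"
    by (metis cd_scale_minus_one cd_scale_scale minus_minus mult_minus1)
  have z: "z = cd_scale (z 0) (cd_unit 0) + M" by (simp add: M_def)
  have M0: "M = 0" if "m = 0"
  proof (rule ext)
    fix k show "M k = 0 k"
      using abs_le_sqrt_cd_sq[of k r M] that M(1) by (cases "k < 2 ^ r") (auto simp: m_def cd_carrier_def)
  qed
  have u: "cd_unit 0 \<in> cd_carrier r" by (simp add: cd_unit_def cd_carrier_def)
  \<comment> \<open>This is multiplication of a + i b m by z_0 + i m in the complex numbers, with
    \<open>M\<close> in place of i m. Powers of \<open>z\<close> therefore stay in the span of
    \<open>cd_unit 0\<close> and \<open>M\<close>.\<close>
  have step: "cd_mult r z (cd_scale a (cd_unit 0) + cd_scale b M)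
      = cd_scale (z 0 * a - m * (b * m)) (cd_unit 0) + cd_scale (z 0 * b + a) M" for a b
    by (subst z, simp only: cd_mult_add cd_mult_scale cd_mult_unit_0[OF M(1)]
        cd_mult_unit_0[OF u] MM)
      (simp add: fun_eq_iff cd_scale_def algebra_simps)
  show ?thesis
  proof (induction k)
    case 0
    show ?case by (simp add: fun_eq_iff cd_scale_def)
  next
    case (Suc k)
    let ?a = "Re (Complex (z 0) m ^ k)" and ?b = "Im (Complex (z 0) m ^ k)"
    have eq: "cd_power r z (Suc k) = cd_scale (z 0 * ?a - m * (?b / m * m)) (cd_unit 0)
        + cd_scale (z 0 * (?b / m) + ?a) M"
      by (simp only: cd_power.simps Suc step)
    show ?case
    proof (cases "m = 0")
      case True
      with M0 show ?thesis unfolding eq by (simp add: fun_eq_iff cd_scale_def)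
    next
      case False
      then have "z 0 * (?b / m) + ?a = (z 0 * ?b + m * ?a) / m" by (simp add: field_simps)
      with False show ?thesis unfolding eq by simp
    qed
  qed
qed

text \<open>By \<open>cd_power_eq\<close> the series sums to the real part of exp w times the unit
  plus the imaginary part times M / m. Since the modulus of exp w is \<open>exp (z 0)\<close> and no
  coordinate of \<open>M\<close> exceeds \<open>m\<close>, each summand contributes at most
  \<open>exp (z 0)\<close>.\<close>

lemma abs_cd_exp_le:
  assumes z: "z \<in> cd_carrier r" and j: "j < 2 ^ r"
  shows "\<bar>cd_exp r z j\<bar> \<le> 2 * exp (z 0)"
proof -
  define M where "M = z - cd_scale (z 0) (cd_unit 0)"
  define m where "m = sqrt (cd_sq r M)"
  define w where "w = Complex (z 0) m"
  have "(\<lambda>k. w ^ k /\<^sub>R fact k) sums exp w" by (rule exp_converges)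
  then have re: "(\<lambda>k. Re (w ^ k) / fact k) sums Re (exp w)"
    and im: "(\<lambda>k. Im (w ^ k) / fact k) sums Im (exp w)"
    using sums_Re sums_Im by (fastforce simp: divide_inverse mult.commute)+
  have "(\<lambda>k. (Re (w ^ k) / fact k) * cd_unit 0 j + (Im (w ^ k) / fact k) * (M j / m))
      sums (Re (exp w) * cd_unit 0 j + Im (exp w) * (M j / m))"
    by (intro sums_add sums_mult2 re im)
  moreover have "cd_power r z k j / fact k
      = (Re (w ^ k) / fact k) * cd_unit 0 j + (Im (w ^ k) / fact k) * (M j / m)" for k
    unfolding cd_power_eq[OF z] w_def m_def M_def
    by (simp add: cd_scale_def add_divide_distrib mult.commute)
  ultimately have exp: "cd_exp r z j = Re (exp w) * cd_unit 0 j + Im (exp w) * (M j / m)"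
    by (simp add: cd_exp_def sums_iff)
  have "\<bar>M j\<bar> \<le> m" using j by (simp add: m_def abs_le_sqrt_cd_sq)
  \<comment> \<open>This includes \<open>m = 0\<close>, where the quotient is 0 by
    convention.\<close>
  then have "\<bar>M j / m\<bar> \<le> 1" by (auto simp: divide_le_eq)
  moreover have "\<bar>cd_unit 0 j\<bar> \<le> 1" by (simp add: cd_unit_def)
  moreover have "\<bar>Re (exp w)\<bar> \<le> exp (z 0)" "\<bar>Im (exp w)\<bar> \<le> exp (z 0)"
    using abs_Re_le_cmod[of "exp w"] abs_Im_le_cmod[of "exp w"] by (simp_all add: w_def)
  ultimately have "\<bar>Re (exp w) * cd_unit 0 j\<bar> \<le> exp (z 0) * 1"
    "\<bar>Im (exp w) * (M j / m)\<bar> \<le> exp (z 0) * 1"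
    unfolding abs_mult by (intro mult_mono; simp)+
  then show ?thesis unfolding exp by linarith
qed


section \<open>Measurability and integrability\<close>

lemma borel_measurable_cd_mult:
  assumes "\<And>k. (\<lambda>t. x t k) \<in> borel_measurable N" "\<And>k. (\<lambda>t. y t k) \<in> borel_measurable N"
  shows "(\<lambda>t. cd_mult r (x t) (y t) k) \<in> borel_measurable N"
  using assms
proof (induction r arbitrary: x y k)
  case 0
  then show ?case by (simp add: cd_scale_def)
next
  case (Suc r)
  have fs: "(\<lambda>t. cd_fst r (x t) k) \<in> borel_measurable N" "(\<lambda>t. cd_snd r (x t) k) \<in> borel_measurable N"
    if "\<And>k. (\<lambda>t. x t k) \<in> borel_measurable N" for k and x :: "_ \<Rightarrow> cd"
    using that by (simp_all add: cd_fst_def cd_snd_def)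
  have cj: "(\<lambda>t. cd_conj r (x t) k) \<in> borel_measurable N"
    if "\<And>k. (\<lambda>t. x t k) \<in> borel_measurable N" for k and x :: "_ \<Rightarrow> cd"
    using that by (simp add: cd_conj_apply)
  show ?case
    by (cases "k < 2 ^ r"; cases "k < 2 ^ Suc r")
      (auto simp: Let_def cd_pair_def
        intro!: borel_measurable_diff borel_measurable_add Suc.IH fs cj Suc.prems)
qed

lemma borel_measurable_cd_exp:
  assumes "\<And>k. (\<lambda>t. x t k) \<in> borel_measurable N"
  shows "(\<lambda>t. cd_exp r (x t) j) \<in> borel_measurable N"
proof -
  have "(\<lambda>t. cd_power r (x t) k j) \<in> borel_measurable N" for k j
    by (induction k arbitrary: j) (simp_all add: borel_measurable_cd_mult assms)
  then show ?thesis unfolding cd_exp_def by measurable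
qed

text \<open>Off a null set \<open>N\<close> containing the discontinuities, \<open>g\<close> is
  continuous on a measurable set; the part of a preimage inside \<open>N\<close> is measurable
  because Lebesgue measure is complete.\<close>

lemma borel_measurable_lebesgue_AE_continuous:
  fixes g :: "'a::euclidean_space \<Rightarrow> real"
  assumes "AE t in lebesgue. isCont g t"
  shows "g \<in> borel_measurable lebesgue"
proof -
  obtain N where N: "N \<in> null_sets lebesgue" "{t. \<not> isCont g t} \<subseteq> N"
    using assms by (auto simp: eventually_ae_filter)
  then have S: "- N \<in> sets lebesgue" by (simp add: null_setsD2 Compl_in_sets_lebesgue)
  have "continuous_on (- N) g"
    using N(2) by (intro continuous_at_imp_continuous_on) auto
  then have g: "(\<lambda>t. if t \<in> - N then g t else 0) \<in> borel_measurable lebesgue"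
    using continuous_imp_measurable_on_sets_lebesgue S by (metis borel_measurable_if)
  show ?thesis
  proof (rule measurableI)
    fix A :: "real set" assume "A \<in> sets borel"
    with g have "(\<lambda>t. if t \<in> - N then g t else 0) -` A \<inter> - N \<in> sets lebesgue"
      using measurable_sets[OF g] S by (auto intro!: sets.Int)
    moreover have "g -` A \<inter> N \<in> sets lebesgue"
      using N(1) by (intro completion.complete[of _ N]) auto
    moreover have "g -` A = ((\<lambda>t. if t \<in> - N then g t else 0) -` A \<inter> - N) \<union> (g -` A \<inter> N)"
      by auto
    ultimately show "g -` A \<inter> space lebesgue \<in> sets lebesgue"
      by (simp only: space_completion space_lborel space_borel Int_UNIV_right) (metis sets.Un)
  qed simp
qed

lemma integrable_exp_abs:
  fixes c :: real
  assumes "0 < c"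
  shows "integrable lborel (\<lambda>x. exp (- c * \<bar>x\<bar>))"
proof -
  define h where "h x = indicator {0..} x * exp (- c * x)" for x :: real
  have "(\<lambda>x. exp (- c * x)) absolutely_integrable_on {0..}"
    by (intro nonnegative_absolutely_integrable_1 integrable_on_exp_minus_to_infinity assms) auto
  then have "integrable lebesgue h" by (simp add: set_integrable_def h_def[abs_def])
  then have "integrable lebesgue (\<lambda>x. h x + h (- x))"
    using lebesgue_integrable_real_affine[of h "- 1" 0] by (intro Bochner_Integration.integrable_add) auto
  \<comment> \<open>The function \<open>h x + h (- x)\<close> equals the target except at 0, where
    it is 2; hence domination instead of equality.\<close>
  then have "integrable lebesgue (\<lambda>x. exp (- c * \<bar>x\<bar>))"
    by (rule Bochner_Integration.integrable_bound)
      (auto simp: h_def indicator_def intro!: borel_measurable_continuous_onI measurable_completion continuous_intros)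
  then show ?thesis by (subst (asm) integrable_completion) auto
qed

text \<open>The integrand is a product of functions of one coordinate each, so its integral is a
  finite product of one-dimensional integrals.\<close>

lemma integrable_exp_sum_Basis:
  fixes c :: real
  assumes "0 < c"
  shows "integrable lborel (\<lambda>t::'a::euclidean_space. exp (- c * (\<Sum>b\<in>Basis. \<bar>t \<bullet> b\<bar>)))"
proof (rule integrableI_bounded)
  have "(\<integral>\<^sup>+ x. ennreal (norm (exp (- c * \<bar>x\<bar>))) \<partial>lborel) < \<infinity>"
    using integrable_exp_abs[OF assms] by (simp add: integrable_iff_bounded)
  then have "(\<Prod>b\<in>(Basis::'a set). \<integral>\<^sup>+ x. ennreal (exp (- c * \<bar>x\<bar>)) \<partial>lborel) < \<infinity>"
    by (simp add: power_less_top_ennreal)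
  also have "(\<Prod>b\<in>(Basis::'a set). \<integral>\<^sup>+ x. ennreal (exp (- c * \<bar>x\<bar>)) \<partial>lborel)
      = (\<integral>\<^sup>+ t. (\<Prod>b\<in>Basis. ennreal (exp (- c * \<bar>t \<bullet> b\<bar>))) \<partial>(lborel :: 'a measure))"
    by (rule nn_integral_lborel_prod[symmetric]) auto
  also have "\<dots> = (\<integral>\<^sup>+ t. ennreal (norm (exp (- c * (\<Sum>b\<in>Basis. \<bar>t \<bullet> b\<bar>)))) \<partial>(lborel :: 'a measure))"
    by (intro nn_integral_cong) (simp add: prod_ennreal exp_sum sum_distrib_left abs_prod flip: sum_negf)
  finally show "(\<integral>\<^sup>+ t. ennreal (norm (exp (- c * (\<Sum>b\<in>Basis. \<bar>t \<bullet> b\<bar>)))) \<partial>(lborel :: 'a measure)) < \<infinity>" .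
qed measurable

lemma integrable_exp_sum_abs:
  fixes c :: real
  assumes "0 < c"
  shows "integrable lebesgue (\<lambda>t::real ^ 'n::finite. exp (- c * (\<Sum>j\<in>UNIV. \<bar>t $ j\<bar>)))"
proof -
  have "(\<Sum>b\<in>Basis. \<bar>t \<bullet> b\<bar>) = (\<Sum>j\<in>UNIV. \<bar>t $ j\<bar>)" for t :: "real ^ 'n"
  proof -
    have "(Basis :: (real ^ 'n) set) = (\<lambda>j. axis j 1) ` UNIV" by (auto simp: Basis_vec_def)
    moreover have "inj (\<lambda>j::'n. axis j (1::real))" by (simp add: inj_def axis_eq_axis)
    ultimately show ?thesis
      using sum.reindex[of "\<lambda>j::'n. axis j (1::real)" UNIV "\<lambda>b. \<bar>t \<bullet> b\<bar>"]
      by (simp add: inner_axis o_def)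
  qed
  with integrable_exp_sum_Basis[OF assms, where 'a = "real ^ 'n"] show ?thesis
    by (simp add: integrable_completion)
qed

text \<open>Translation is an affine map with all scale factors 1. The completed measure is used
  since an original is only known to be Lebesgue measurable.\<close>

lemma
  fixes \<tau> :: "'a::euclidean_space" and g :: "'a \<Rightarrow> real"
  assumes g: "integrable lebesgue g"
  shows integrable_lebesgue_shift: "integrable lebesgue (\<lambda>t. g (\<tau> + t))"
    and integral_lebesgue_shift: "integral\<^sup>L lebesgue (\<lambda>t. g (\<tau> + t)) = integral\<^sup>L lebesgue g"
proof -
  have eq: "lebesgue = distr lebesgue lebesgue ((+) \<tau>)"
    using lebesgue_affine_euclidean[of "\<lambda>_. 1" \<tau>] by (simp add: euclidean_representation density_1)
  have m: "(+) \<tau> \<in> lebesgue \<rightarrow>\<^sub>M lebesgue"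
    using lebesgue_affine_measurable[of "\<lambda>_. 1" \<tau>] by (simp add: euclidean_representation)
  have gm: "g \<in> borel_measurable lebesgue" using g by auto
  show "integrable lebesgue (\<lambda>t. g (\<tau> + t))"
    using integrable_distr_eq[OF m gm] g by (simp flip: eq)
  show "integral\<^sup>L lebesgue (\<lambda>t. g (\<tau> + t)) = integral\<^sup>L lebesgue g"
    using integral_distr[OF m gm] by (simp flip: eq)
qed

section \<open>Existence of the transform and its behaviour under translation\<close>

lemma finite_sign_patterns: "finite {v :: 'n::finite \<Rightarrow> int. range v \<subseteq> {- 1, 1}}"
  using finite_PiE[of "UNIV :: 'n set" "\<lambda>_. {- 1, 1 :: int}"]
  by (rule rev_finite_subset) (auto simp: image_subset_iff)

text \<open>On the orthant with signs \<open>v\<close> the exponent is the sum of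
  \<open>(a (v j) - p0) * t $ j\<close>, and every term is negative for nonzero \<open>t $ j\<close>
  because \<open>p0\<close> lies strictly between \<open>a 1\<close> and
  \<open>a (- 1)\<close>.\<close>

lemma cd_original_growth:
  fixes f :: "real ^ 'n::finite \<Rightarrow> cd"
  assumes f: "cd_original r a f" and p0: "a 1 < p0" "p0 < a (- 1)"
  obtains D c where "0 < c" "0 < D"
    "\<And>t. cd_norm r (f t) * exp (- (p0 * (\<Sum>j\<in>UNIV. t $ j))) \<le> D * exp (- c * (\<Sum>j\<in>UNIV. \<bar>t $ j\<bar>))"
proof -
  let ?V = "{v :: 'n \<Rightarrow> int. range v \<subseteq> {- 1, 1}}"
  have "\<forall>v\<in>?V. \<exists>C>0. \<forall>t. (\<forall>j. 0 \<le> of_int (v j) * t $ j) \<longrightarrow>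
           cd_norm r (f t) < C * exp (\<Sum>j\<in>UNIV. a (v j) * t $ j)"
    using f by (auto simp: cd_original_def)
  from bchoice[OF this] obtain C where C: "\<And>v. v \<in> ?V \<Longrightarrow> 0 < C v"
      "\<And>v t. v \<in> ?V \<Longrightarrow> (\<And>j. 0 \<le> of_int (v j) * t $ j) \<Longrightarrow>
           cd_norm r (f t) < C v * exp (\<Sum>j\<in>UNIV. a (v j) * t $ j)"
    by blast
  \<comment> \<open>The decay rate is the distance from \<open>p0\<close> to the nearer end of the
    strip.\<close>
  define c where "c = min (p0 - a 1) (a (- 1) - p0)"
  have V: "(\<lambda>_. 1) \<in> ?V" by auto
  show ?thesis
  proof
    show "0 < c" using p0 by (simp add: c_def)
    \<comment> \<open>Summing the constants over the finitely many orthants gives one valid for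
      all.\<close>
    show "0 < sum C ?V" using C(1) V finite_sign_patterns by (intro sum_pos) auto
    fix t :: "real ^ 'n"
    define v where "v j = (if 0 \<le> t $ j then 1 else - 1 :: int)" for j
    have v: "v \<in> ?V" by (auto simp: v_def)
    have le: "a (v j) * t $ j - p0 * t $ j \<le> - c * \<bar>t $ j\<bar>" for j
    proof (cases "0 \<le> t $ j")
      case True
      then have "c * t $ j \<le> (p0 - a 1) * t $ j" by (intro mult_right_mono) (auto simp: c_def)
      with True show ?thesis by (simp add: v_def algebra_simps)
    next
      case False
      then have "(a (- 1) - p0) * t $ j \<le> c * t $ j" by (intro mult_right_mono_neg) (auto simp: c_def)
      with False show ?thesis by (simp add: v_def algebra_simps)
    qed
    have "cd_norm r (f t) \<le> C v * exp (\<Sum>j\<in>UNIV. a (v j) * t $ j)"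
      using C(2)[OF v, of t] by (force simp: v_def)
    also have "\<dots> \<le> sum C ?V * exp (\<Sum>j\<in>UNIV. a (v j) * t $ j)"
      using C(1) v finite_sign_patterns
      by (intro mult_right_mono member_le_sum) (auto intro: less_imp_le)
    finally have "cd_norm r (f t) * exp (- (p0 * (\<Sum>j\<in>UNIV. t $ j)))
        \<le> sum C ?V * exp (\<Sum>j\<in>UNIV. a (v j) * t $ j) * exp (- (p0 * (\<Sum>j\<in>UNIV. t $ j)))"
      by simp
    also have "\<dots> = sum C ?V * exp (\<Sum>j\<in>UNIV. a (v j) * t $ j - p0 * t $ j)"
      by (simp add: sum_subtractf sum_distrib_left exp_diff exp_minus divide_inverse)
    also have "\<dots> \<le> sum C ?V * exp (\<Sum>j\<in>UNIV. - c * \<bar>t $ j\<bar>)"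
      using \<open>0 < sum C ?V\<close> le by (intro mult_left_mono) (auto intro!: sum_mono simp del: mult_minus_left)
    finally show "cd_norm r (f t) * exp (- (p0 * (\<Sum>j\<in>UNIV. t $ j)))
        \<le> sum C ?V * exp (- c * (\<Sum>j\<in>UNIV. \<bar>t $ j\<bar>))"
      by (simp add: sum_distrib_left)
  qed
qed

text \<open>Isolates what existence needs from a kernel. Only its real part affects the size of the
  exponential, and both kernels have the same one.\<close>

lemma transform_existsI:
  fixes f :: "real ^ 'n::finite \<Rightarrow> cd"
  assumes f: "cd_original r a f" and p: "p \<in> cd_strip r a"
    and carrier: "\<And>t. u p t \<zeta> \<in> cd_carrier r"
    and meas: "\<And>k. (\<lambda>t. u p t \<zeta> k) \<in> borel_measurable borel"
    and re: "\<And>t. u p t \<zeta> 0 = p 0 * (\<Sum>j\<in>UNIV. t $ j) + \<zeta> 0"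
  shows "transform_exists r f u p \<zeta>"
  unfolding transform_exists_def
proof
  fix k
  have fc: "f t \<in> cd_carrier r" for t using f by (auto simp: cd_original_def)
  have "a 1 < p 0" "p 0 < a (- 1)"
    using p by (auto simp: cd_strip_def cd_Re_def cd_conj_apply)
  from cd_original_growth[OF f this] obtain D c where D: "0 < c" "0 < D"
    "\<And>t. cd_norm r (f t) * exp (- (p 0 * (\<Sum>j\<in>UNIV. t $ j))) \<le> D * exp (- c * (\<Sum>j\<in>UNIV. \<bar>t $ j\<bar>))"
    by metis
  show "integrable lebesgue (\<lambda>t. transform_integrand r f u p \<zeta> t k)"
  proof (rule Bochner_Integration.integrable_bound)
    \<comment> \<open>The factor \<open>2 ^ r\<close> comes from \<open>abs_cd_mult_le\<close>, 2
      from \<open>abs_cd_exp_le\<close>, \<open>exp (- \<zeta> 0)\<close> from the constant term of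
      the kernel, and \<open>D\<close> from the growth estimate.\<close>
    show "integrable lebesgue
        (\<lambda>t::real ^ 'n. 2 ^ r * 2 * exp (- \<zeta> 0) * D * exp (- c * (\<Sum>j\<in>UNIV. \<bar>t $ j\<bar>)))"
      by (intro integrable_mult_right integrable_exp_sum_abs D(1))
    have "AE t in lebesgue. isCont f t" using f by (simp add: cd_original_def)
    moreover have "isCont (\<lambda>x. x i) x" for i and x :: cd
      using continuous_on_product_coordinates by (rule continuous_on_interior) simp
    ultimately have "AE t in lebesgue. isCont (\<lambda>t. f t i) t" for i
      by (auto elim!: eventually_mono intro: isCont_o2[where g = "\<lambda>x. x i"])
    then have "(\<lambda>t. f t i) \<in> borel_measurable lebesgue" for i
      by (rule borel_measurable_lebesgue_AE_continuous)
    moreover have "(\<lambda>t. (- u p t \<zeta>) i) \<in> borel_measurable lebesgue" for i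
      using meas[of i] by (simp add: measurable_completion)
    ultimately show "(\<lambda>t. transform_integrand r f u p \<zeta> t k) \<in> borel_measurable lebesgue"
      unfolding transform_integrand_def by (intro borel_measurable_cd_mult borel_measurable_cd_exp)
    show "AE t in lebesgue. norm (transform_integrand r f u p \<zeta> t k)
        \<le> norm (2 ^ r * 2 * exp (- \<zeta> 0) * D * exp (- c * (\<Sum>j\<in>UNIV. \<bar>t $ j\<bar>)))"
    proof (rule AE_I2)
      fix t
      have "- u p t \<zeta> \<in> cd_carrier r" using carrier[of t] by (simp add: cd_carrier_def)
      then have "\<bar>cd_exp r (- u p t \<zeta>) i\<bar> \<le> 2 * exp (- u p t \<zeta> 0)" if "i < 2 ^ r" for i
        using abs_cd_exp_le that by fastforce
      moreover have "\<bar>f t i\<bar> \<le> cd_norm r (f t)" if "i < 2 ^ r" for i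
        using abs_le_sqrt_cd_sq[OF that] by (simp add: cd_norm_eq fc)
      moreover have "0 \<le> cd_norm r (f t)" by (simp add: cd_norm_eq fc cd_sq_def sum_nonneg)
      ultimately have "\<bar>transform_integrand r f u p \<zeta> t k\<bar>
          \<le> 2 ^ r * cd_norm r (f t) * (2 * exp (- u p t \<zeta> 0))"
        unfolding transform_integrand_def by (intro abs_cd_mult_le) auto
      also have "\<dots> = 2 ^ r * 2 * exp (- \<zeta> 0) * (cd_norm r (f t) * exp (- (p 0 * (\<Sum>j\<in>UNIV. t $ j))))"
        by (simp add: re exp_diff exp_minus exp_add algebra_simps divide_inverse)
      also have "\<dots> \<le> 2 ^ r * 2 * exp (- \<zeta> 0) * (D * exp (- c * (\<Sum>j\<in>UNIV. \<bar>t $ j\<bar>)))"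
        by (intro mult_left_mono D(3)) simp
      finally show "norm (transform_integrand r f u p \<zeta> t k)
        \<le> norm (2 ^ r * 2 * exp (- \<zeta> 0) * D * exp (- c * (\<Sum>j\<in>UNIV. \<bar>t $ j\<bar>)))"
        using D(2) by (simp add: abs_mult mult_ac)
    qed
  qed
qed

text \<open>The kernel identity makes the shifted integrand a translate of the original one, so
  existence and value carry over together.\<close>

lemma transform_shift:
  fixes f :: "real ^ 'n::finite \<Rightarrow> cd"
  assumes kernel: "\<And>t. u p (t + \<tau>) \<zeta> = u p t \<zeta>'"
    and ex: "transform_exists r f u p \<zeta>'"
  shows "transform_exists r (\<lambda>t. f (t - \<tau>)) u p \<zeta> \<and> transform_exists r f u p \<zeta>' \<and>
    transform r (\<lambda>t. f (t - \<tau>)) u p \<zeta> = transform r f u p \<zeta>'"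
proof -
  have eq: "transform_integrand r (\<lambda>t. f (t - \<tau>)) u p \<zeta> t k
      = transform_integrand r f u p \<zeta>' (- \<tau> + t) k" for t k
    using kernel[of "t - \<tau>"] by (simp add: transform_integrand_def)
  show ?thesis
    using ex integrable_lebesgue_shift[of _ "- \<tau>"] integral_lebesgue_shift[of _ "- \<tau>"]
    unfolding transform_exists_def transform_def eq by blast
qed


section \<open>The two kernels\<close>

lemma sum_scale_unit: "(\<Sum>j=1..n. cd_scale (c j) (cd_unit j)) k = (if 1 \<le> k \<and> k \<le> n then c k else 0)"
proof -
  have "(\<Sum>j=1..n. cd_scale (c j) (cd_unit j)) k = (\<Sum>j=1..n. if k = j then c j else 0)"
    by (induction n) (auto simp: cd_scale_def cd_unit_def)
  then show ?thesis by simp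
qed

lemma tail_sum_add: "tail_sum e j (t + s) = tail_sum e j t + tail_sum e j s"
  by (simp add: tail_sum_def sum.distrib)

lemma borel_measurable_tail_sum [measurable]:
  "tail_sum e j \<in> borel_measurable (borel :: (real ^ 'n::finite) measure)"
  unfolding tail_sum_def by (intro borel_measurable_continuous_onI continuous_intros)

lemma tail_sum_1:
  assumes "bij_betw e {1..CARD('n)} (UNIV :: 'n::finite set)"
  shows "tail_sum e 1 t = (\<Sum>j\<in>UNIV. t $ j)"
  unfolding tail_sum_def using sum.reindex_bij_betw[OF assms, of "\<lambda>j. t $ j"] by simp

lemma kernel_cartesian_apply:
  fixes e :: "nat \<Rightarrow> 'n::finite"
  shows "kernel_cartesian e p t \<zeta> k =
    (if k = 0 then p 0 * tail_sum e 1 t else if k \<le> CARD('n) then p k * t $ e k else 0) + \<zeta> k"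
  unfolding kernel_cartesian_def plus_fun_apply sum_scale_unit
  by (simp add: cd_scale_def cd_unit_def tail_sum_def)

lemma bracket_cartesian_apply:
  fixes e :: "nat \<Rightarrow> 'n::finite"
  shows "bracket_cartesian e p t k =
    (if k = 0 then p 0 * tail_sum e 1 t else if k \<le> CARD('n) then p k * t $ e k else 0)"
  unfolding bracket_cartesian_def plus_fun_apply sum_scale_unit
  by (simp add: cd_scale_def cd_unit_def tail_sum_def)

lemma bracket_spherical_apply:
  fixes e :: "nat \<Rightarrow> 'n::finite"
  shows "bracket_spherical e p t k =
    (if k = 0 then p 0 * tail_sum e 1 t else if k \<le> CARD('n) then p k * tail_sum e k t else 0)"
  unfolding bracket_spherical_def plus_fun_apply sum_scale_unit
  by (simp add: cd_scale_def cd_unit_def)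

lemma kernel_cartesian_shift:
  "kernel_cartesian e p (t + \<tau>) \<zeta> = kernel_cartesian e p t (\<zeta> + bracket_cartesian e p \<tau>)"
  by (simp add: fun_eq_iff kernel_cartesian_apply bracket_cartesian_apply tail_sum_add algebra_simps)

text \<open>At \<open>k = 1\<close> the product of sines is empty, leaving the cosine of phase 2;
  coordinate \<open>K\<close> carries no cosine and is therefore kept separate.\<close>

lemma kernel_spherical_apply:
  fixes e :: "nat \<Rightarrow> 'n::finite" and p \<zeta> :: cd and r :: nat
  defines "\<phi> \<equiv> \<lambda>t j. p j * tail_sum e j t + \<zeta> j"
  defines "K \<equiv> 2 ^ r - 1"
  shows "kernel_spherical r e p t \<zeta> k =
    p 0 * tail_sum e 1 t * cd_unit 0 k
    + \<phi> t 1 * ((if 1 \<le> k \<and> k \<le> K - 1 then (\<Prod>l=2..k. sin (\<phi> t l)) * cos (\<phi> t (k + 1)) else 0)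
       + (\<Prod>l=2..K. sin (\<phi> t l)) * cd_unit K k)
    + \<zeta> 0 * cd_unit 0 k"
  unfolding kernel_spherical_def Let_def plus_fun_apply cd_scale_def[of "_ * _ + _"] sum_scale_unit \<phi>_def K_def
  by (simp add: cd_scale_def)

text \<open>The kernel sees \<open>t\<close> and \<open>\<zeta>\<close> only through the phases of
  index at least 1 and through p_0 s_1 + \<zeta>_0, and the bracket absorbs the translation in each
  of these.\<close>

lemma kernel_spherical_shift:
  fixes e :: "nat \<Rightarrow> 'n::finite"
  assumes "\<forall>m>CARD('n). p m = 0"
  shows "kernel_spherical r e p (t + \<tau>) \<zeta> = kernel_spherical r e p t (\<zeta> + bracket_spherical e p \<tau>)"
proof -
  \<comment> \<open>Index 0 is excluded: there the bracket uses \<open>tail_sum e 1\<close>, not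
    \<open>tail_sum e 0\<close>.\<close>
  have phase: "p j * tail_sum e j (t + \<tau>) + \<zeta> j
      = p j * tail_sum e j t + (\<zeta> + bracket_spherical e p \<tau>) j" if "1 \<le> j" for j
    using assms that by (auto simp: bracket_spherical_apply tail_sum_add algebra_simps)
  have sines: "(\<Prod>l=2..k. sin (p l * tail_sum e l (t + \<tau>) + \<zeta> l))
      = (\<Prod>l=2..k. sin (p l * tail_sum e l t + (\<zeta> + bracket_spherical e p \<tau>) l))" for k
    by (intro prod.cong) (auto simp only: phase atLeastAtMost_iff)
  have 0: "(\<zeta> + bracket_spherical e p \<tau>) 0 = \<zeta> 0 + p 0 * tail_sum e 1 \<tau>"
    by (simp add: bracket_spherical_apply)
  show ?thesis
    \<comment> \<open>Outside the sines, phases occur only at index 1 (the leading factor) and at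
      \<open>k + 1\<close> (the cosine).\<close>
    unfolding fun_eq_iff kernel_spherical_apply sines phase[OF order_refl] phase[OF le_add2] 0
    by (simp only: tail_sum_add) (simp add: algebra_simps)
qed

theorem theorem14:
  fixes r :: nat and e :: "nat \<Rightarrow> 'n::finite" and \<tau> :: "real ^ 'n"
    and f :: "real ^ 'n \<Rightarrow> cd" and a :: "int \<Rightarrow> real" and p \<zeta> :: cd
  assumes "2 \<le> r" and "2 ^ (r - 1) \<le> CARD('n)" and "CARD('n) \<le> 2 ^ r - 1"
    and "bij_betw e {1..CARD('n)} UNIV"
    and "cd_original r a f"
    and "p \<in> cd_strip r a" and "\<zeta> \<in> cd_carrier r"
    and "\<forall>m>CARD('n). p m = 0 \<and> \<zeta> m = 0"
  shows "(transform_exists r (\<lambda>t. f (t - \<tau>)) (kernel_spherical r e) p \<zeta> \<and>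
          transform_exists r f (kernel_spherical r e) p (\<zeta> + bracket_spherical e p \<tau>) \<and>
          transform r (\<lambda>t. f (t - \<tau>)) (kernel_spherical r e) p \<zeta>
            = transform r f (kernel_spherical r e) p (\<zeta> + bracket_spherical e p \<tau>)) \<and>
         (transform_exists r (\<lambda>t. f (t - \<tau>)) (kernel_cartesian e) p \<zeta> \<and>
          transform_exists r f (kernel_cartesian e) p (\<zeta> + bracket_cartesian e p \<tau>) \<and>
          transform r (\<lambda>t. f (t - \<tau>)) (kernel_cartesian e) p \<zeta>
            = transform r f (kernel_cartesian e) p (\<zeta> + bracket_cartesian e p \<tau>))"
proof -
  note sum1 = tail_sum_1[OF assms(4)]
  \<comment> \<open>This makes \<open>2 ^ r - 1\<close> a genuine subtraction with positive value,
    so the last spherical unit differs from \<open>cd_unit 0\<close> and does not disturb the real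
    part.\<close>
  have r: "(4::nat) \<le> 2 ^ r" using power_increasing[OF assms(1), of "2::nat"] by simp
  have n: "CARD('n) < 2 ^ r" using assms(3) r by linarith
  have cart: "transform_exists r f (kernel_cartesian e) p (\<zeta> + bracket_cartesian e p \<tau>)"
  proof (rule transform_existsI[OF assms(5,6)])
    fix t :: "real ^ 'n" and k
    show "kernel_cartesian e p t (\<zeta> + bracket_cartesian e p \<tau>) \<in> cd_carrier r"
      using n assms(7) by (auto simp: cd_carrier_def kernel_cartesian_apply bracket_cartesian_apply)
    show "(\<lambda>t. kernel_cartesian e p t (\<zeta> + bracket_cartesian e p \<tau>) k) \<in> borel_measurable borel"
      unfolding kernel_cartesian_apply
      by (cases "k = 0") (auto intro!: borel_measurable_continuous_onI continuous_intros simp: tail_sum_def)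
    show "kernel_cartesian e p t (\<zeta> + bracket_cartesian e p \<tau>) 0
        = p 0 * (\<Sum>j\<in>UNIV. t $ j) + (\<zeta> + bracket_cartesian e p \<tau>) 0"
      by (simp add: kernel_cartesian_apply flip: sum1)
  qed
  have sph: "transform_exists r f (kernel_spherical r e) p (\<zeta> + bracket_spherical e p \<tau>)"
  proof (rule transform_existsI[OF assms(5,6)])
    fix t :: "real ^ 'n" and k
    show "kernel_spherical r e p t (\<zeta> + bracket_spherical e p \<tau>) \<in> cd_carrier r"
      using r by (auto simp: cd_carrier_def kernel_spherical_apply cd_unit_def)
    show "(\<lambda>t. kernel_spherical r e p t (\<zeta> + bracket_spherical e p \<tau>) k) \<in> borel_measurable borel"
      unfolding kernel_spherical_apply by measurable
    show "kernel_spherical r e p t (\<zeta> + bracket_spherical e p \<tau>) 0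
        = p 0 * (\<Sum>j\<in>UNIV. t $ j) + (\<zeta> + bracket_spherical e p \<tau>) 0"
      using r by (simp add: kernel_spherical_apply cd_unit_def flip: sum1)
  qed
  have "\<forall>m>CARD('n). p m = 0" using assms(8) by blast
  then show ?thesis
    using transform_shift[of "kernel_spherical r e", OF kernel_spherical_shift sph]
      transform_shift[of "kernel_cartesian e", OF kernel_cartesian_shift cart]
    by blast
qed

end
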